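(* Let $d\ge 1$ and $k\ge 0$ be fixed integers. The polynomial sequence $\big(H^{(d)}_q(n,k)\big)_{n\ge k}$ is $q$-log-concave; that is, for all $n\ge k+1$ the polynomial $H^{(d)}_q(n,k)^2-H^{(d)}_q(n-1,k)\,H^{(d)}_q(n+1,k)$ in $q$ has only nonnegative coefficients.
   Context: For $d\ge1$ and $0\le k\le n$ the $q$-analogue of the $d$-Hoggatt number is $$H^{(d)}_q(n,k)=q^{\frac{dk(k-1)}{2}}\prod_{j=0}^{d-1}\frac{\begin{bmatrix} n+j\\ k\end{bmatrix}_q}{\begin{bmatrix} k+j\\ k\end{bmatrix}_q},$$ where $[m]_q=\frac{1-q^m}{1-q}$, $[m]_q!=[1]_q[2]_q\cdots[m]_q$ and $\begin{bmatrix} n\\ k\end{bmatrix}_q=\frac{[n]_q!}{[k]_q!\,[n-k]_q!}$. It is a polynomial in $q$. A sequence of real polynomials $(f_n(q))$ is $q$-log-concave if $f_n(q)^2-f_{n-1}(q)f_{n+1}(q)$ has only nonnegative coefficients for every interior index $n$. *)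

theory Defs
  imports "HOL-Computational_Algebra.Computational_Algebra" "HOL-Computational_Algebra.Field_as_Ring"
begin

text \<open>
  The $q$-numbers and everything built from them are written down with literal quotients in the
  field of rational functions in one indeterminate over the reals.
\<close>

definition qvar :: "real poly fract" where
  "qvar = to_fract [:0, 1:]"

definition q_int :: "nat \<Rightarrow> real poly fract" where
  "q_int m = (1 - qvar ^ m) / (1 - qvar)"

definition q_fact :: "nat \<Rightarrow> real poly fract" where
  "q_fact m = (\<Prod>i=1..m. q_int i)"

text \<open>Only meaningful for \<open>k \<le> n\<close>, since \<open>n - k\<close> is truncated.\<close>

definition q_binomial :: "nat \<Rightarrow> nat \<Rightarrow> real poly fract" where
  "q_binomial n k = q_fact n / (q_fact k * q_fact (n - k))"

definition q_hoggatt_fract :: "nat \<Rightarrow> nat \<Rightarrow> nat \<Rightarrow> real poly fract" where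
  "q_hoggatt_fract d n k =
     qvar ^ (d * k * (k - 1) div 2) * (\<Prod>j<d. q_binomial (n + j) k / q_binomial (k + j) k)"

text \<open>
  For \<open>k \<le> n\<close> the rational function above is a polynomial (lemma \<open>to_fract_q_hoggatt\<close>
  below), necessarily unique because \<open>to_fract\<close> is injective.
\<close>

definition q_hoggatt :: "nat \<Rightarrow> nat \<Rightarrow> nat \<Rightarrow> real poly" where
  "q_hoggatt d n k = (THE p. to_fract p = q_hoggatt_fract d n k)"

text \<open>The sequence is indexed by \<open>n \<ge> m\<close>, so its interior indices are the \<open>n > m\<close>.\<close>

definition q_log_concave_from :: "nat \<Rightarrow> (nat \<Rightarrow> real poly) \<Rightarrow> bool" where
  "q_log_concave_from m f \<longleftrightarrow>
     (\<forall>n\<ge>m + 1. \<forall>i. 0 \<le> coeff ((f n)\<^sup>2 - f (n - 1) * f (n + 1)) i)"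

subsection \<open>Polynomiality\<close>

definition qpol :: "nat \<Rightarrow> real poly" where
  "qpol m = 1 - [:0, 1:] ^ m"

lemma qpol_nz: "m > 0 \<Longrightarrow> qpol m \<noteq> 0"
proof
  assume "m > 0" "qpol m = 0"
  then have "poly (qpol m) 0 = 0" by simp
  with \<open>m > 0\<close> show False by (simp add: qpol_def poly_power power_0_left)
qed

lemma to_fract_power: "to_fract (p ^ m) = to_fract p ^ m"
  by (induction m) auto

lemma q_int_conv: "q_int m = to_fract (qpol m) / to_fract (qpol 1)"
  by (simp add: q_int_def qvar_def qpol_def to_fract_power)

lemma q_int_nz: "m > 0 \<Longrightarrow> q_int m \<noteq> 0"
  by (simp add: q_int_conv qpol_nz)

lemma q_fact_nz: "q_fact m \<noteq> 0"
  by (auto simp: q_fact_def q_int_nz)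

lemma q_fact_Suc: "q_fact (Suc m) = q_fact m * q_int (Suc m)"
  by (simp add: q_fact_def)

lemma q_fact_falling:
  "k \<le> n \<Longrightarrow> q_fact n = q_fact (n - k) * (\<Prod>i<k. q_int (n - i))"
proof (induction k)
  case (Suc k)
  have "n - k = Suc (n - Suc k)" using Suc.prems by simp
  then have "q_fact (n - k) = q_fact (n - Suc k) * q_int (n - k)"
    by (simp add: q_fact_Suc)
  with Suc show ?case by (simp add: ac_simps)
qed simp

lemma q_binomial_ratio:
  assumes "k \<le> n" "k \<le> m"
  shows "q_binomial n k / q_binomial m k =
         to_fract (\<Prod>i<k. qpol (n - i)) / to_fract (\<Prod>i<k. qpol (m - i))"
proof -
  have b: "q_binomial a k = (\<Prod>i<k. q_int (a - i)) / q_fact k" if "k \<le> a" for a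
    using q_fact_falling[OF that] q_fact_nz[of "a - k"] q_fact_nz[of k]
    by (simp add: q_binomial_def field_simps)
  have tp: "to_fract (\<Prod>i<k. g i) = (\<Prod>i<k. to_fract (g i))" for g :: "nat \<Rightarrow> real poly"
    by (induction k) auto
  have c: "(\<Prod>i<k. q_int (a - i)) = to_fract (\<Prod>i<k. qpol (a - i)) / to_fract (qpol 1) ^ k" for a
    by (simp add: q_int_conv prod_dividef tp)
  have "to_fract (qpol 1) \<noteq> 0" by (simp add: qpol_nz)
  then show ?thesis
    using q_fact_nz[of k] by (simp add: b[OF assms(1)] b[OF assms(2)] c)
qed

lemma qpol_multiplicity_le_1:
  assumes p: "prime_elem p" and m: "m > 0"
  shows "multiplicity p (qpol m) \<le> 1"
proof (rule ccontr)
  assume "\<not> multiplicity p (qpol m) \<le> 1"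
  then have "2 \<le> multiplicity p (qpol m)" by simp
  then have "p ^ 2 dvd qpol m" by (rule multiplicity_dvd')
  then obtain r where r: "qpol m = p * (p * r)"
    by (metis dvd_def power2_eq_square mult.assoc)
  then have d: "p dvd pderiv (qpol m)" by (simp add: pderiv_mult)
  have "pderiv ([:0, 1 :: real:] ^ m) = smult (of_nat m) ([:0, 1:] ^ (m - 1))"
    using m by (cases m) (simp_all add: pderiv_power_Suc pderiv_pCons del: power_Suc)
  then have pd: "pderiv (qpol m) = - smult (of_nat m) ([:0, 1:] ^ (m - 1))"
    by (simp add: qpol_def pderiv_diff)
  have "[:0, 1:] * pderiv (qpol m) = - smult (of_nat m) ([:0, 1 :: real:] ^ m)"
    unfolding pd by (subst power_eq_if) (use m in simp)
  then have "of_nat m = smult (of_nat m) (qpol m) - [:0, 1:] * pderiv (qpol m)"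
    by (simp add: qpol_def smult_diff_right of_nat_poly)
  also have "p dvd \<dots>" using d r by (intro dvd_diff dvd_mult dvd_smult) simp_all
  finally have "p dvd of_nat m" .
  moreover have "is_unit (of_nat m :: real poly)"
    using m by (simp add: of_nat_poly is_unit_const_poly_iff dvd_field_iff)
  ultimately have "is_unit p" by (rule dvd_unit_imp_unit)
  with p show False by simp
qed

lemma prime_dvd_qpol_cases:
  assumes p: "prime_elem p"
  obtains "\<And>m. m > 0 \<Longrightarrow> \<not> p dvd qpol m"
  | e where "e > 0" "\<And>m. p dvd qpol m \<longleftrightarrow> e dvd m"
proof (cases "\<exists>m>0. p dvd qpol m")
  case True
  define e where "e = (LEAST m. m > 0 \<and> p dvd qpol m)"
  have e: "e > 0" "p dvd qpol e"
    using LeastI_ex[of "\<lambda>m. m > 0 \<and> p dvd qpol m"] True unfolding e_def by auto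
  have least: "e \<le> m" if "m > 0" "p dvd qpol m" for m
    unfolding e_def using that by (intro Least_le) auto
  have step: "p dvd qpol (e + r) \<longleftrightarrow> p dvd qpol r" for r
  proof -
    have "qpol (e + r) = qpol e * [:0, 1:] ^ r + qpol r"
      by (simp add: qpol_def power_add algebra_simps)
    then show ?thesis using e(2) by (simp add: dvd_add_right_iff)
  qed
  have "p dvd qpol m \<longleftrightarrow> e dvd m" for m
  proof (induction m rule: less_induct)
    case (less m)
    show ?case
    proof (cases "m < e")
      case True
      then show ?thesis
        using least[of m] by (cases "m = 0") (auto simp: qpol_def dest: dvd_imp_le)
    next
      case False
      then have m: "m = e + (m - e)" by simp
      have "p dvd qpol m \<longleftrightarrow> p dvd qpol (m - e)"
        using step[of "m - e"] False by simp
      also have "\<dots> \<longleftrightarrow> e dvd m - e"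
        using less.IH[of "m - e"] e(1) False by simp
      also have "\<dots> \<longleftrightarrow> e dvd m" using False by (metis dvd_minus_self not_less)
      finally show ?thesis .
    qed
  qed
  with e(1) show ?thesis using that(2) by blast
next
  case False
  then show ?thesis using that(1) by blast
qed

lemma count_multiples:
  fixes e :: nat
  assumes e: "e > 0" and "k \<le> m"
  shows "(\<Sum>i<k. if e dvd m - i then 1 else 0) =
         k div e + (if m mod e < k mod e then 1 else (0::nat))"
proof -
  have "(\<Sum>i<k. if e dvd m - i then 1 else 0) + (m - k) div e = m div e"
    using assms(2)
  proof (induction k)
    case (Suc k)
    have "m - k = Suc (m - Suc k)" using Suc.prems by simp
    then have "(m - k) div e = (m - Suc k) div e + (if e dvd m - k then 1 else 0)"
      by (simp add: div_Suc dvd_eq_mod_eq_0)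
    with Suc show ?case by simp
  qed simp
  moreover have "m div e = (m - k) div e + k div e + (if m mod e < k mod e then 1 else 0)"
  proof -
    define x where "x = m - k"
    have m: "m = x + k" using assms(2) x_def by simp
    have x: "x mod e < e" and k: "k mod e < e" using e by auto
    show ?thesis
    proof (cases "x mod e + k mod e < e")
      case True
      then have "(x mod e + k mod e) div e = 0" "(x + k) mod e = x mod e + k mod e"
        by (simp, metis mod_add_eq mod_less)
      then show ?thesis unfolding x_def[symmetric] unfolding m
        by (subst div_add1_eq) simp
    next
      case False
      then have s1: "(x mod e + k mod e) div e = 1"
        using add_strict_mono[OF x k] by (intro div_nat_eqI) auto
      have carry: "x mod e + k mod e - e < e" using add_strict_mono[OF x k] False by simp
      have s2: "(x + k) mod e = x mod e + k mod e - e"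
        by (metis False le_mod_geq mod_add_eq mod_less not_less carry)
      have "(x + k) mod e < k mod e" using s2 x False by linarith
      with s1 show ?thesis unfolding x_def[symmetric] unfolding m
        by (subst div_add1_eq) simp
    qed
  qed
  ultimately show ?thesis by simp
qed

lemma full_window:
  fixes e :: nat and g :: "nat \<Rightarrow> nat"
  assumes e: "e > 0"
  shows "(\<Sum>j<e. g ((n + j) mod e)) = (\<Sum>t<e. g t)"
proof (induction n)
  case (Suc n)
  obtain e' where e': "e = Suc e'" using e by (cases e) auto
  have "(\<Sum>j<e. g ((Suc n + j) mod e)) = (\<Sum>j<e'. g ((n + Suc j) mod e)) + g ((n + e) mod e)"
    by (simp add: e' del: mod_add_self2)
  also have "g ((n + e) mod e) = g ((n + 0) mod e)" by simp
  also have "(\<Sum>j<e'. g ((n + Suc j) mod e)) + g ((n + 0) mod e) = (\<Sum>j<e. g ((n + j) mod e))"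
    unfolding e' sum.lessThan_Suc_shift by simp
  finally show ?case using Suc by simp
qed simp

lemma window_count:
  fixes e :: nat
  assumes e: "e > 0" and r: "r < e"
  shows "(\<Sum>j<d. if (r + j) mod e < r then 1 else (0::nat)) \<le>
         (\<Sum>j<d. if (n + j) mod e < r then 1 else 0)"
proof (induction d rule: less_induct)
  case (less d)
  define I :: "nat \<Rightarrow> nat" where "I t = (if t < r then 1 else 0)" for t
  have tot: "(\<Sum>j<e. I ((a + j) mod e)) = r" for a
  proof -
    have "(\<Sum>t<e. I t) = card ({..<e} \<inter> {t. t < r})"
      by (simp add: I_def sum.If_cases)
    also have "{..<e} \<inter> {t. t < r} = {..<r}" using r by auto
    finally show ?thesis using full_window[OF e, of I] by simp
  qed
  show ?case
  proof (cases "d < e")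
    case False
    then obtain d' where d': "d = d' + e" by (metis add.commute le_Suc_ex not_less)
    have split: "(\<Sum>j<d. I ((a + j) mod e)) = (\<Sum>j<d'. I ((a + j) mod e)) + r" for a
    proof -
      have "(\<Sum>j<d' + e. I ((a + j) mod e)) =
            (\<Sum>j<d'. I ((a + j) mod e)) + (\<Sum>j<e. I ((a + (d' + j)) mod e))"
        using sum.atLeastLessThan_concat[of 0 d' "d' + e" "\<lambda>j. I ((a + j) mod e)"]
          sum.shift_bounds_nat_ivl[of "\<lambda>j. I ((a + j) mod e)" 0 d' e]
        by (simp add: atLeast0LessThan ac_simps)
      then show ?thesis using tot[of "a + d'"] by (simp add: d' add.assoc)
    qed
    have "d' < d" using e d' by simp
    from less.IH[OF this] show ?thesis
      using split[of r] split[of n] unfolding I_def by simp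
  next
    case True
    have compl: "(\<Sum>j<d. I ((a + j) mod e)) + (\<Sum>j<d. 1 - I ((a + j) mod e)) = d" for a
      by (simp add: sum.distrib[symmetric] I_def if_distrib cong: if_cong)
    have totc: "(\<Sum>j<e. 1 - I ((a + j) mod e)) = e - r" for a
    proof -
      have "(\<Sum>j<e. I ((a + j) mod e)) + (\<Sum>j<e. 1 - I ((a + j) mod e)) = e"
        by (simp add: sum.distrib[symmetric] I_def if_distrib cong: if_cong)
      then show ?thesis using tot[of a] by simp
    qed
    have sub: "(\<Sum>j<d. 1 - I ((n + j) mod e)) \<le> e - r"
      using sum_mono2[of "{..<e}" "{..<d}" "\<lambda>j. 1 - I ((n + j) mod e)"] True totc[of n] by auto
    show ?thesis
    proof (cases "d \<le> e - r")
      case True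
      then have "(\<Sum>j<d. I ((r + j) mod e)) = 0" by (auto simp: I_def)
      then show ?thesis unfolding I_def by simp
    next
      case False
      have "(\<Sum>j<e - r. 1 - I ((r + j) mod e)) = (\<Sum>j<e - r. 1)"
        by (intro sum.cong) (auto simp: I_def)
      then have "e - r \<le> (\<Sum>j<d. 1 - I ((r + j) mod e))"
        using sum_mono2[of "{..<d}" "{..<e - r}" "\<lambda>j. 1 - I ((r + j) mod e)"] False by auto
      then have "(\<Sum>j<d. I ((r + j) mod e)) \<le> (\<Sum>j<d. I ((n + j) mod e))"
        using compl[of r] compl[of n] sub by linarith
      then show ?thesis unfolding I_def .
    qed
  qed
qed

lemma qpol_products_dvd:
  assumes "k \<le> n"
  shows "(\<Prod>j<d. \<Prod>i<k. qpol (k + j - i)) dvd (\<Prod>j<d. \<Prod>i<k. qpol (n + j - i))"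
proof (rule multiplicity_le_imp_dvd)
  have nz: "(\<Prod>i<k. qpol (a + j - i)) \<noteq> 0" if "k \<le> a" for a j
    using that by (auto simp: qpol_nz)
  show "(\<Prod>j<d. \<Prod>i<k. qpol (k + j - i)) \<noteq> 0" using nz by auto
  fix p :: "real poly" assume "prime p"
  then have p: "prime_elem p" by auto
  have mult: "multiplicity p (\<Prod>j<d. \<Prod>i<k. qpol (a + j - i)) =
              (\<Sum>j<d. \<Sum>i<k. multiplicity p (qpol (a + j - i)))" if "k \<le> a" for a
    using p nz[OF that] that by (simp add: prime_elem_multiplicity_prod_distrib qpol_nz image_iff)
  from p show "multiplicity p (\<Prod>j<d. \<Prod>i<k. qpol (k + j - i)) \<le>
               multiplicity p (\<Prod>j<d. \<Prod>i<k. qpol (n + j - i))"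
  proof (cases rule: prime_dvd_qpol_cases)
    case 1
    then show ?thesis unfolding mult[OF order_refl]
      by (simp add: not_dvd_imp_multiplicity_0)
  next
    case (2 e)
    have m: "multiplicity p (qpol m) = (if e dvd m then 1 else 0)" if "m > 0" for m
    proof (cases "e dvd m")
      case True
      then have "multiplicity p (qpol m) > 0"
        using 2(2)[of m] p qpol_nz[OF that]
        by (metis gr0I multiplicity_eq_zero_iff prime_elem_not_unit)
      with qpol_multiplicity_le_1[OF p that] True show ?thesis by simp
    qed (use 2(2) in \<open>simp add: not_dvd_imp_multiplicity_0\<close>)
    have row: "(\<Sum>i<k. multiplicity p (qpol (a + j - i))) =
        k div e + (if (a + j) mod e < k mod e then 1 else 0)" if "k \<le> a" for a j
    proof -
      have "(\<Sum>i<k. multiplicity p (qpol (a + j - i))) = (\<Sum>i<k. if e dvd a + j - i then 1 else 0)"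
        using that by (intro sum.cong refl m) auto
      then show ?thesis using count_multiples[OF 2(1), of k "a + j"] that by simp
    qed
    have red: "(k + j) mod e = (k mod e + j) mod e" for j by (simp add: mod_add_left_eq)
    show ?thesis
      unfolding mult[OF order_refl] mult[OF assms] row[OF order_refl] row[OF assms]
        sum.distrib red
      using window_count[OF 2(1), of "k mod e" d n] 2(1) by simp
  qed
qed

lemma to_fract_q_hoggatt:
  assumes "k \<le> n"
  shows "to_fract (q_hoggatt d n k) = q_hoggatt_fract d n k"
proof -
  define D where "D = (\<Prod>j<d. \<Prod>i<k. qpol (k + j - i))"
  obtain c where c: "(\<Prod>j<d. \<Prod>i<k. qpol (n + j - i)) = D * c"
    using qpol_products_dvd[OF assms, of d] unfolding D_def by (elim dvdE)
  have D: "D \<noteq> 0" by (auto simp: D_def qpol_nz)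
  have tp: "to_fract (\<Prod>j<d. g j) = (\<Prod>j<d. to_fract (g j))" for g :: "nat \<Rightarrow> real poly"
    by (induction d) auto
  have "(\<Prod>j<d. q_binomial (n + j) k / q_binomial (k + j) k) =
        (\<Prod>j<d. to_fract (\<Prod>i<k. qpol (n + j - i)) / to_fract (\<Prod>i<k. qpol (k + j - i)))"
    using assms by (intro prod.cong refl q_binomial_ratio) auto
  also have "\<dots> = to_fract (D * c) / to_fract D"
    by (simp add: prod_dividef tp[symmetric] c D_def del: to_fract_mult)
  also have "\<dots> = to_fract c" using D by simp
  finally have H: "to_fract ([:0, 1:] ^ (d * k * (k - 1) div 2) * c) = q_hoggatt_fract d n k"
    by (simp add: q_hoggatt_fract_def qvar_def to_fract_power)
  then show ?thesis unfolding q_hoggatt_def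
    by (rule theI) (metis H to_fract_eq_iff)
qed

end

theory Submission
  imports Defs "Jordan_Normal_Form.Determinant"
begin

text \<open>
  Put \<open>c = n - k\<close>. Up to a power of \<open>q\<close> that does not depend on \<open>n\<close>, the rational function
  defining \<open>H(n, k)\<close> is MacMahon's generating function \<open>M(k, d, c)\<close> of the plane partitions in a
  \<open>k \<times> d \<times> c\<close> box. With \<open>S(m) = [0]! [1]! \<dots> [m-1]!\<close> the product formula takes the symmetric shape
    \<open>M(a, b, c) = S(a) S(b) S(c) S(a+b+c) / (S(a+b) S(a+c) S(b+c))\<close>,
  from which two facts follow.

  The first is a condensation identity (\<open>macmahon_dodgson\<close>)
    \<open>M(a,b,c)^2 - M(a,b,c-1) M(a,b,c+1) = q^c M(a+1,b-1,c) M(a-1,b+1,c)\<close>.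
  After division by \<open>M(a,b,c)\<^sup>2\<close> the two products \<open>M(a,b,c-1) M(a,b,c+1)\<close> and
  \<open>M(a+1,b-1,c) M(a-1,b+1,c)\<close> become quotients of \<open>q\<close>-numbers with the same denominator
  \<open>[a+c][b+c]\<close>, and what is left is \<open>[a+c][b+c] - [c][a+b+c] = q\<^sup>c [a][b]\<close>. Condensation expresses
  the difference in question as a product, so it remains to see that each \<open>M(a,b,c)\<close> has
  nonnegative coefficients.

  The second is that \<open>M(k,d,c)\<close> is, up to a power of \<open>q\<close>, the principal specialization
  \<open>s(1, q, \<dots>, q\<^bsup>k+d-1\<^esup>)\<close> of the Schur function of the rectangle with \<open>k\<close> rows of length \<open>c\<close>
  (\<open>principal_schur_rectangle\<close>). By the bialternant formula such a specialization is a quotient of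
  two Vandermonde determinants in powers of \<open>q\<close>. Its positivity, for arbitrary shapes, is an
  induction on the number of variables through the branching rule (\<open>principal_schur_branching\<close>):
  a Vandermonde determinant of size \<open>n + 1\<close> is a \<open>q\<close>-integral of one of size \<open>n\<close> over all
  interlacing sequences (\<open>sum_vandermonde_interlacing\<close>). This passes through shapes that are not
  rectangles, which is why the product formula for boxes alone would not support the induction.
\<close>

section \<open>Determinants and Vandermonde products\<close>

text \<open>
  Subtracting \<open>c\<close> times the preceding column from every column but the first, that is, multiplying by
  a unitriangular matrix, clears the first row apart from its leading entry \<open>1\<close>. Both evaluations of
  Vandermonde type below are instances: \<open>c = x 0\<close> on the matrix itself and \<open>c = 1\<close> on its transpose.
\<close>

lemma det_geometric_first_row:
  fixes f :: "nat \<Rightarrow> nat \<Rightarrow> 'a :: idom"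
  assumes "f 0 0 = 1" and geometric: "\<And>j. j < n \<Longrightarrow> f 0 (Suc j) = c * f 0 j"
  shows "det (mat (Suc n) (Suc n) (\<lambda>(i, j). f i j)) =
         det (mat n n (\<lambda>(i, j). f (Suc i) (Suc j) - c * f (Suc i) j))"
proof -
  define A where "A = mat (Suc n) (Suc n) (\<lambda>(i, j). f i j)"
  define U where "U = mat (Suc n) (Suc n)
    (\<lambda>(i, j). if i = j then 1 else if Suc i = j then - c else 0)"
  define B where "B = mat (Suc n) (Suc n)
    (\<lambda>(i, j). case j of 0 \<Rightarrow> f i 0 | Suc j' \<Rightarrow> f i (Suc j') - c * f i j')"
  have carrier: "A \<in> carrier_mat (Suc n) (Suc n)" "U \<in> carrier_mat (Suc n) (Suc n)"
    "B \<in> carrier_mat (Suc n) (Suc n)"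
    by (simp_all add: A_def U_def B_def)
  have "upper_triangular U" by (auto simp: U_def)
  then have "det U = 1"
    using det_upper_triangular[of U "Suc n"] carrier
    by (simp add: prod_list_diag_prod U_def)
  have "A * U = B"
  proof (rule eq_matI)
    fix i j assume "i < dim_row B" "j < dim_col B"
    then have i: "i < Suc n" and j: "j < Suc n" by (simp_all add: B_def)
    have "(A * U) $$ (i, j) =
        (\<Sum>k<Suc n. f i k * (if k = j then 1 else if Suc k = j then - c else 0))"
      using i j
      by (simp add: A_def U_def scalar_prod_def lessThan_atLeast0 del: sum.op_ivl_Suc)
    also have "\<dots> = (\<Sum>k<Suc n. (if k = j then f i k else 0))
        + (\<Sum>k<Suc n. (if Suc k = j then - c * f i k else 0))"
      unfolding sum.distrib[symmetric] by (intro sum.cong refl) auto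
    also have "\<dots> = (case j of 0 \<Rightarrow> f i 0 | Suc j' \<Rightarrow> f i (Suc j') - c * f i j')"
      using j by (cases j) (simp_all del: sum.lessThan_Suc)
    finally show "(A * U) $$ (i, j) = B $$ (i, j)" using i j by (simp add: B_def)
  qed (simp_all add: A_def U_def B_def)
  then have "det A = det B"
    using det_mult[OF carrier(1,2)] \<open>det U = 1\<close> by simp
  also have "det B = (\<Sum>j<Suc n. B $$ (0, j) * cofactor B 0 j)"
    using laplace_expansion_row[OF carrier(3), of 0] by simp
  also have "\<dots> = B $$ (0, 0) * cofactor B 0 0"
    using geometric by (simp add: sum.lessThan_Suc_shift B_def del: sum.lessThan_Suc)
  also have "\<dots> = det (mat_delete B 0 0)"
    using assms(1) by (simp add: B_def cofactor_def)
  also have "mat_delete B 0 0 = mat n n (\<lambda>(i, j). f (Suc i) (Suc j) - c * f (Suc i) j)"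
    by (rule eq_matI) (simp_all add: mat_delete_def B_def)
  finally show ?thesis by (simp add: A_def)
qed

lemma det_mat_leibniz:
  fixes f :: "nat \<Rightarrow> nat \<Rightarrow> 'a :: comm_ring_1"
  shows "det (mat n n (\<lambda>(i, j). f i j)) =
         (\<Sum>p | p permutes {0..<n}. signof p * (\<Prod>i = 0..<n. f i (p i)))"
  unfolding det_def
  by (auto intro!: sum.cong prod.cong arg_cong2[of _ _ _ _ times] simp: permutes_in_image)

lemma det_scale_rows_columns:
  fixes f :: "nat \<Rightarrow> nat \<Rightarrow> 'a :: comm_ring_1"
  shows "det (mat n n (\<lambda>(i, j). a i * b j * f i j)) =
         (\<Prod>i<n. a i) * (\<Prod>j<n. b j) * det (mat n n (\<lambda>(i, j). f i j))"
proof -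
  have "(\<Prod>i = 0..<n. a i * b (p i) * f i (p i)) =
        (\<Prod>i<n. a i) * (\<Prod>j<n. b j) * (\<Prod>i = 0..<n. f i (p i))"
    if "p permutes {0..<n}" for p
    using prod.permute[OF that, of b] by (simp add: prod.distrib lessThan_atLeast0 comp_def)
  then show ?thesis
    unfolding det_mat_leibniz sum_distrib_left
    by (intro sum.cong refl) (simp add: mult.left_commute)
qed

text \<open>
  Multilinearity in the rows. Row \<open>i\<close> is summed over its own index set \<open>B i\<close>, independently of the
  other rows; in the Leibniz formula this is the distributive law for a product of sums.
\<close>

lemma det_sum_rows:
  fixes f :: "nat \<Rightarrow> 'b \<Rightarrow> 'a :: comm_ring_1"
  assumes "\<And>i. i < n \<Longrightarrow> finite (B i)"
  shows "(\<Sum>m \<in> Pi\<^sub>E {..<n} B. det (mat n n (\<lambda>(i, j). f j (m i)))) =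
         det (mat n n (\<lambda>(i, j). \<Sum>t \<in> B i. f j t))"
proof -
  have "(\<Prod>i = 0..<n. \<Sum>t\<in>B i. f (p i) t) =
        (\<Sum>m \<in> Pi\<^sub>E {..<n} B. \<Prod>i = 0..<n. f (p i) (m i))" for p
    using prod_sum_PiE[of "{..<n}" B "\<lambda>i. f (p i)"] assms by (simp add: lessThan_atLeast0)
  moreover have "(\<Sum>m \<in> Pi\<^sub>E {..<n} B. \<Sum>p | p permutes {0..<n}. 
        signof p * (\<Prod>i = 0..<n. f (p i) (m i))) =
      (\<Sum>p | p permutes {0..<n}. signof p * 
        (\<Sum>m \<in> Pi\<^sub>E {..<n} B. \<Prod>i = 0..<n. f (p i) (m i)))"
    by (subst sum.swap) (simp add: sum_distrib_left)
  ultimately show ?thesis by (simp add: det_mat_leibniz)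
qed

definition vandermonde :: "nat \<Rightarrow> (nat \<Rightarrow> 'a :: comm_ring_1) \<Rightarrow> 'a" where
  "vandermonde n x = (\<Prod>j<n. \<Prod>i<j. x j - x i)"

lemma det_vandermonde:
  fixes x :: "nat \<Rightarrow> 'a :: idom"
  shows "det (mat n n (\<lambda>(i, j). x i ^ j)) = vandermonde n x"
proof (induction n arbitrary: x)
  case (Suc n)
  have "det (mat (Suc n) (Suc n) (\<lambda>(i, j). x i ^ j)) =
        det (mat n n (\<lambda>(i, j). x (Suc i) ^ Suc j - x 0 * x (Suc i) ^ j))"
    by (rule det_geometric_first_row) simp_all
  also have "\<dots> = det (mat n n (\<lambda>(i, j). (x (Suc i) - x 0) * 1 * x (Suc i) ^ j))"
    by (simp add: algebra_simps)
  also have "\<dots> = (\<Prod>i<n. x (Suc i) - x 0) * vandermonde n (x \<circ> Suc)"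
    unfolding det_scale_rows_columns using Suc.IH[of "x \<circ> Suc"] by (simp add: comp_def)
  also have "\<dots> = vandermonde (Suc n) x"
    unfolding vandermonde_def prod.lessThan_Suc_shift by (simp add: prod.distrib)
  finally show ?case .
qed (simp add: vandermonde_def)

text \<open>
  Transposed, the matrix of differences is what remains of the Vandermonde matrix of size \<open>n + 1\<close>
  after its row of ones has been cleared.
\<close>

lemma det_vandermonde_differences:
  fixes x :: "nat \<Rightarrow> 'a :: idom"
  shows "det (mat n n (\<lambda>(i, j). x (Suc i) ^ Suc j - x i ^ Suc j)) = vandermonde (Suc n) x"
proof -
  have "det (mat n n (\<lambda>(i, j). x (Suc i) ^ Suc j - x i ^ Suc j)) =
        det (mat n n (\<lambda>(i, j). x (Suc j) ^ Suc i - 1 * x j ^ Suc i))"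
    by (subst det_transpose[of _ n, symmetric]) (auto intro!: arg_cong[of _ _ det])
  also have "\<dots> = det (mat (Suc n) (Suc n) (\<lambda>(i, j). x j ^ i))"
    by (rule det_geometric_first_row[symmetric]) simp_all
  also have "\<dots> = det (mat (Suc n) (Suc n) (\<lambda>(i, j). x i ^ j))"
    by (subst det_transpose[of _ "Suc n", symmetric]) (auto intro!: arg_cong[of _ _ det])
  finally show ?thesis by (simp only: det_vandermonde)
qed

text \<open>
  The weight \<open>q ^ m i\<close> raises the exponents of row \<open>i\<close> from \<open>0, \<dots>, n - 1\<close> to \<open>1, \<dots>, n\<close>, so the sum
  over \<open>m i\<close> is a geometric series in every column: the discrete form of integrating \<open>y ^ j\<close> from
  \<open>q ^ l i\<close> to \<open>q ^ l (i + 1)\<close>. The denominators depend on the column alone, and the numerators are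
  the differences of \<open>det_vandermonde_differences\<close>. The half-open ranges of the \<open>m i\<close> are the
  interlacing condition for strictly increasing sequences.
\<close>

lemma sum_vandermonde_interlacing:
  fixes q :: "'a :: field" and l :: "nat \<Rightarrow> nat"
  assumes q: "\<And>j. 0 < j \<Longrightarrow> q ^ j \<noteq> 1" and l: "\<And>i. i < n \<Longrightarrow> l i \<le> l (Suc i)"
  shows "(\<Sum>m \<in> (\<Pi>\<^sub>E i\<in>{..<n}. {l i..<l (Suc i)}).
            (\<Prod>i<n. q ^ m i) * vandermonde n (\<lambda>i. q ^ m i)) * (\<Prod>j<n. q ^ Suc j - 1) =
         vandermonde (Suc n) (\<lambda>i. q ^ l i)"
proof -
  have weighted: "(\<Prod>i<n. q ^ m i) * vandermonde n (\<lambda>i. q ^ m i) =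
      det (mat n n (\<lambda>(i, j). (q ^ Suc j) ^ m i))" for m :: "nat \<Rightarrow> nat"
  proof -
    \<comment> \<open>Here and below a factor \<open>1\<close> is written where only rows, or only columns, are scaled.\<close>
    have "(q ^ Suc j) ^ m i = q ^ m i * 1 * (q ^ m i) ^ j" for i j
      by (simp add: power_mult_distrib power_mult[symmetric] mult.commute)
    then show ?thesis by (simp only: det_scale_rows_columns det_vandermonde) simp
  qed
  have geometric: "(\<Sum>t = l i..<l (Suc i). (q ^ Suc j) ^ t) =
      1 * (1 / (q ^ Suc j - 1)) * ((q ^ l (Suc i)) ^ Suc j - (q ^ l i) ^ Suc j)"
    if "i < n" for i j
  proof -
    have "(\<Sum>t = l i..<l (Suc i). (q ^ Suc j) ^ t) * (q ^ Suc j - 1) =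
        (\<Sum>t = l i..<l (Suc i). (q ^ Suc j) ^ Suc t - (q ^ Suc j) ^ t)"
      unfolding sum_distrib_right
      by (intro sum.cong refl) (simp add: algebra_simps del: power_Suc add: power_Suc[of "q ^ Suc j"])
    also have "\<dots> = (q ^ Suc j) ^ l (Suc i) - (q ^ Suc j) ^ l i"
      by (rule sum_Suc_diff'[OF l[OF that]])
    also have "\<dots> = (q ^ l (Suc i)) ^ Suc j - (q ^ l i) ^ Suc j"
      by (simp only: power_mult[symmetric] mult.commute)
    finally show ?thesis
      using q[of "Suc j"] by (simp add: field_simps del: power_Suc)
  qed
  have "(\<Sum>m \<in> (\<Pi>\<^sub>E i\<in>{..<n}. {l i..<l (Suc i)}).
            (\<Prod>i<n. q ^ m i) * vandermonde n (\<lambda>i. q ^ m i)) =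
      det (mat n n (\<lambda>(i, j). \<Sum>t = l i..<l (Suc i). (q ^ Suc j) ^ t))"
    unfolding weighted by (rule det_sum_rows) simp
  also have "mat n n (\<lambda>(i, j). \<Sum>t = l i..<l (Suc i). (q ^ Suc j) ^ t) =
      mat n n (\<lambda>(i, j). 1 * (1 / (q ^ Suc j - 1)) * ((q ^ l (Suc i)) ^ Suc j - (q ^ l i) ^ Suc j))"
    by (rule eq_matI) (simp_all only: dim_row_mat dim_col_mat index_mat split geometric)
  also have "det \<dots> = (\<Prod>j<n. 1 / (q ^ Suc j - 1)) * vandermonde (Suc n) (\<lambda>i. q ^ l i)"
    unfolding det_scale_rows_columns det_vandermonde_differences[of n "\<lambda>i. q ^ l i"] by simp
  finally show ?thesis
    using q by (simp add: prod_dividef del: power_Suc)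
qed

section \<open>Rational functions that are polynomials with nonnegative coefficients\<close>

definition nonneg_fract :: "real poly fract set" where
  "nonneg_fract = to_fract ` {p. \<forall>i. 0 \<le> coeff p i}"

lemma nonneg_fract_0: "0 \<in> nonneg_fract"
  unfolding nonneg_fract_def by (rule image_eqI[of _ _ 0]) simp_all

lemma nonneg_fract_1: "1 \<in> nonneg_fract"
  unfolding nonneg_fract_def by (rule image_eqI[of _ _ 1]) (simp_all add: coeff_1)

lemma nonneg_fract_add: "x \<in> nonneg_fract \<Longrightarrow> y \<in> nonneg_fract \<Longrightarrow> x + y \<in> nonneg_fract"
  unfolding nonneg_fract_def by (auto simp flip: to_fract_add)

lemma nonneg_fract_mult: "x \<in> nonneg_fract \<Longrightarrow> y \<in> nonneg_fract \<Longrightarrow> x * y \<in> nonneg_fract"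
proof -
  assume "x \<in> nonneg_fract" "y \<in> nonneg_fract"
  then obtain p r where "x * y = to_fract (p * r)" "\<And>i. 0 \<le> coeff p i" "\<And>i. 0 \<le> coeff r i"
    by (auto simp: nonneg_fract_def)
  moreover from this have "\<forall>i. 0 \<le> coeff (p * r) i" by (simp add: coeff_mult sum_nonneg)
  ultimately show ?thesis unfolding nonneg_fract_def by blast
qed

lemma nonneg_fract_sum: "(\<And>a. a \<in> A \<Longrightarrow> f a \<in> nonneg_fract) \<Longrightarrow> sum f A \<in> nonneg_fract"
  by (induction A rule: infinite_finite_induct) (simp_all add: nonneg_fract_0 nonneg_fract_add)

lemma nonneg_fract_prod: "(\<And>a. a \<in> A \<Longrightarrow> f a \<in> nonneg_fract) \<Longrightarrow> prod f A \<in> nonneg_fract"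
  by (induction A rule: infinite_finite_induct) (simp_all add: nonneg_fract_1 nonneg_fract_mult)

lemma qvar_power_monom: "qvar ^ e = to_fract (monom 1 e)"
  by (simp add: qvar_def monom_altdef to_fract_power)

lemma nonneg_fract_qvar_power: "qvar ^ e \<in> nonneg_fract"
  by (auto simp: nonneg_fract_def qvar_power_monom)

text \<open>
  A power of \<open>q\<close> only shifts coefficients. Powers of \<open>q\<close> therefore need not be tracked exactly once
  a rational function is known to be a polynomial.
\<close>

lemma nonneg_fract_qvar_cancel:
  assumes "qvar ^ e * to_fract p \<in> nonneg_fract"
  shows "0 \<le> coeff p i"
proof -
  obtain g where "to_fract (monom 1 e * p) = to_fract g" and g: "\<And>i. 0 \<le> coeff g i"
    using assms by (auto simp: nonneg_fract_def qvar_power_monom)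
  then have "monom 1 e * p = g" by (simp only: to_fract_eq_iff)
  then have "coeff p i = coeff g (i + e)" by (auto simp: coeff_monom_mult)
  then show ?thesis using g by simp
qed

section \<open>Principal specializations of Schur functions\<close>

lemma qvar_nz: "qvar \<noteq> 0"
  by (simp add: qvar_def)

lemma qvar_power_neq_1: "0 < m \<Longrightarrow> qvar ^ m \<noteq> 1"
  using q_int_nz[of m] by (auto simp: q_int_def)

lemma qvar_power_diff:
  assumes "i \<le> a"
  shows "qvar ^ a - qvar ^ i = qvar ^ i * (qvar - 1) * q_int (a - i)"
proof -
  have "qvar ^ a = qvar ^ i * qvar ^ (a - i)" using assms by (simp flip: power_add)
  then show ?thesis using qvar_power_neq_1[of 1] by (simp add: q_int_def field_simps)
qed

lemma vandermonde_cong: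
  "(\<And>i. i < n \<Longrightarrow> x i = y i) \<Longrightarrow> vandermonde n x = vandermonde n y"
  unfolding vandermonde_def by (intro prod.cong refl) simp

lemma vandermonde_qvar_nz: "vandermonde n (\<lambda>i. qvar ^ i) \<noteq> 0"
  using qvar_nz qvar_power_neq_1[of 1]
  by (auto simp: vandermonde_def qvar_power_diff q_int_nz)

text \<open>
  The Schur polynomial in the \<open>n\<close> variables \<open>1, q, \<dots>, q ^ (n - 1)\<close>, written as a quotient of
  alternants. The partition is encoded by the strictly increasing sequence \<open>l\<close> of its parts, smallest
  first, with the staircase \<open>0, 1, \<dots>, n - 1\<close> added. With this choice of variables the alternant
  with exponents \<open>l\<close> is itself a Vandermonde product, in the variables \<open>q ^ l i\<close>.
\<close>

definition principal_schur :: "nat \<Rightarrow> (nat \<Rightarrow> nat) \<Rightarrow> real poly fract" where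
  "principal_schur n l =
     vandermonde n (\<lambda>i. qvar ^ l i) / vandermonde n (\<lambda>i. qvar ^ i)"

text \<open>
  Interlacing sums express numerator and denominator with the same factor \<open>W\<close>, which cancels. For
  the denominator, \<open>l i = i\<close>, the only interlacing sequence is the staircase itself.
\<close>

lemma principal_schur_branching:
  assumes l: "\<And>i. i < n \<Longrightarrow> l i < l (Suc i)"
  shows "principal_schur (Suc n) l =
    (\<Sum>m \<in> (\<Pi>\<^sub>E i\<in>{..<n}. {l i..<l (Suc i)}).
       (\<Prod>i<n. qvar ^ (m i - i)) * principal_schur n m)"
proof -
  define W where "W = (\<Prod>j<n. qvar ^ Suc j - 1)"
  define \<Delta> where "\<Delta> m = vandermonde n (\<lambda>i. qvar ^ m i)" for m :: "nat \<Rightarrow> nat"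
  have "W \<noteq> 0" using qvar_power_neq_1[of "Suc _"] by (auto simp: W_def simp del: power_Suc)
  have top: "vandermonde (Suc n) (\<lambda>i. qvar ^ l i) =
      (\<Sum>m \<in> (\<Pi>\<^sub>E i\<in>{..<n}. {l i..<l (Suc i)}). (\<Prod>i<n. qvar ^ m i) * \<Delta> m) * W"
    unfolding W_def \<Delta>_def
    by (rule sum_vandermonde_interlacing[symmetric]) (use l qvar_power_neq_1 in \<open>auto simp: less_imp_le\<close>)
  have "(\<Pi>\<^sub>E i\<in>{..<n}. {i..<Suc i}) = {restrict (\<lambda>i. i) {..<n}}"
  proof -
    have "(\<Pi>\<^sub>E i\<in>{..<n}. {i..<Suc i}) = (\<Pi>\<^sub>E i\<in>{..<n}. {restrict (\<lambda>i. i) {..<n} i})"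
      by (rule PiE_cong) auto
    also have "\<dots> = {restrict (\<lambda>i. i) {..<n}}" by (rule PiE_singleton) (rule restrict_extensional)
    finally show ?thesis .
  qed
  moreover have "\<Delta> (restrict (\<lambda>i. i) {..<n}) = \<Delta> (\<lambda>i. i)"
    unfolding \<Delta>_def by (rule vandermonde_cong) simp
  ultimately have bottom: "vandermonde (Suc n) (\<lambda>i. qvar ^ i) =
      (\<Prod>i<n. qvar ^ i) * \<Delta> (\<lambda>i. i) * W"
    using sum_vandermonde_interlacing[of qvar n "\<lambda>i. i"] qvar_power_neq_1
    by (simp add: W_def \<Delta>_def del: power_Suc)
  \<comment> \<open>This makes the truncated exponents \<open>m i - i\<close> honest, hence all weights polynomial.\<close>
  have rank: "i \<le> l i" if "i \<le> n" for i
    using that by (induction i) (use l in \<open>auto simp: Suc_le_eq intro: le_less_trans\<close>)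
  have quotient: "(\<Prod>i<n. qvar ^ m i) / (\<Prod>i<n. qvar ^ i) = (\<Prod>i<n. qvar ^ (m i - i))"
    if "m \<in> (\<Pi>\<^sub>E i\<in>{..<n}. {l i..<l (Suc i)})" for m
  proof -
    have "i \<le> m i" if "i < n" for i
      using rank[of i] PiE_mem[OF \<open>m \<in> _\<close>, of i] that by simp
    then show ?thesis
      unfolding prod_dividef[symmetric] by (intro prod.cong refl) (simp add: power_diff qvar_nz)
  qed
  have "principal_schur (Suc n) l =
      (\<Sum>m \<in> (\<Pi>\<^sub>E i\<in>{..<n}. {l i..<l (Suc i)}). (\<Prod>i<n. qvar ^ m i) * \<Delta> m)
        / ((\<Prod>i<n. qvar ^ i) * \<Delta> (\<lambda>i. i))"
    unfolding principal_schur_def top bottom using \<open>W \<noteq> 0\<close> by simp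
  also have "\<dots> = (\<Sum>m \<in> (\<Pi>\<^sub>E i\<in>{..<n}. {l i..<l (Suc i)}).
      (\<Prod>i<n. qvar ^ (m i - i)) * principal_schur n m)"
    unfolding sum_divide_distrib principal_schur_def
    by (intro sum.cong refl) (simp add: quotient[symmetric] \<Delta>_def)
  finally show ?thesis .
qed

lemma principal_schur_nonneg:
  assumes "\<And>i. Suc i < n \<Longrightarrow> l i < l (Suc i)"
  shows "principal_schur n l \<in> nonneg_fract"
  using assms
proof (induction n arbitrary: l)
  case 0
  show ?case by (simp add: principal_schur_def vandermonde_def nonneg_fract_1)
next
  case (Suc n)
  show ?case
  proof (subst principal_schur_branching)
    show "l i < l (Suc i)" if "i < n" for i using Suc.prems that by simp
    show "(\<Sum>m \<in> (\<Pi>\<^sub>E i\<in>{..<n}. {l i..<l (Suc i)}).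
        (\<Prod>i<n. qvar ^ (m i - i)) * principal_schur n m) \<in> nonneg_fract"
    proof (intro nonneg_fract_sum nonneg_fract_mult nonneg_fract_prod nonneg_fract_qvar_power
        Suc.IH)
      fix m i assume m: "m \<in> (\<Pi>\<^sub>E i\<in>{..<n}. {l i..<l (Suc i)})" and "Suc i < n"
      then have "m i < l (Suc i)" "l (Suc i) \<le> m (Suc i)"
        using PiE_mem[OF m, of i] PiE_mem[OF m, of "Suc i"] by simp_all
      then show "m i < m (Suc i)" by simp
    qed
  qed
qed

section \<open>MacMahon box numbers\<close>

definition q_superfact :: "nat \<Rightarrow> real poly fract" where
  "q_superfact m = (\<Prod>i<m. q_fact i)"

lemma q_superfact_0: "q_superfact 0 = 1"
  by (simp add: q_superfact_def)

lemma q_superfact_Suc: "q_superfact (Suc m) = q_superfact m * q_fact m"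
  by (simp add: q_superfact_def)

lemma q_superfact_nz: "q_superfact m \<noteq> 0"
  by (simp add: q_superfact_def q_fact_nz)

text \<open>
  MacMahon's product over all \<open>i < a\<close>, \<open>j < b\<close> of \<open>[i + j + c + 1] / [i + j + 1]\<close>, rewritten with
  superfactorials: symmetric in the three side lengths and free of truncated subtraction.
\<close>

definition macmahon :: "nat \<Rightarrow> nat \<Rightarrow> nat \<Rightarrow> real poly fract" where
  "macmahon a b c =
     q_superfact a * q_superfact b * q_superfact c * q_superfact (a + b + c) /
     (q_superfact (a + b) * q_superfact (a + c) * q_superfact (b + c))"

lemma macmahon_commute: "macmahon a b c = macmahon b a c"
  by (simp add: macmahon_def ac_simps)

lemma macmahon_rotate: "macmahon a b c = macmahon c a b"
  by (simp add: macmahon_def ac_simps)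

lemma macmahon_0: "macmahon 0 b c = 1"
  by (simp add: macmahon_def q_superfact_0 q_superfact_nz)

definition macmahon_step :: "nat \<Rightarrow> nat \<Rightarrow> nat \<Rightarrow> real poly fract" where
  "macmahon_step a b c = q_fact a * q_fact (a + b + c) / (q_fact (a + b) * q_fact (a + c))"

lemma macmahon_Suc: "macmahon (Suc a) b c = macmahon a b c * macmahon_step a b c"
  by (simp add: macmahon_def macmahon_step_def q_superfact_Suc ac_simps)

lemma macmahon_step_shift:
  "macmahon_step (Suc a) b c * q_int (Suc (a + c)) =
   macmahon_step a (Suc b) c * q_int (Suc a)"
  using q_fact_nz q_int_nz by (simp add: macmahon_step_def q_fact_Suc ac_simps)

lemma macmahon_step_Suc:
  "macmahon_step (Suc a) b c * (q_int (Suc (a + b)) * q_int (Suc (a + c))) =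
   macmahon_step a b c * (q_int (Suc a) * q_int (Suc (a + b + c)))"
  using q_fact_nz q_int_nz by (simp add: macmahon_step_def q_fact_Suc ac_simps)

text \<open>
  Each of the outer factors on the left is one \<open>macmahon_step\<close> away from \<open>M(a + 1, b)\<close> or
  \<open>M(a, b + 1)\<close>, and \<open>macmahon_step_shift\<close> turns these steps into the ones that lead from there to
  the central \<open>M(a + 1, b + 1)\<close>.
\<close>

lemma macmahon_exchange:
  "macmahon (Suc (Suc a)) b c * macmahon a (Suc (Suc b)) c *
     (q_int (Suc (a + c)) * q_int (Suc (b + c))) =
   (macmahon (Suc a) (Suc b) c)\<^sup>2 * (q_int (Suc a) * q_int (Suc b))"
proof -
  have "macmahon (Suc (Suc a)) b c * macmahon a (Suc (Suc b)) c *
      (q_int (Suc (a + c)) * q_int (Suc (b + c))) =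
      (macmahon (Suc a) b c * (macmahon_step (Suc a) b c * q_int (Suc (a + c)))) *
      (macmahon (Suc b) a c * (macmahon_step (Suc b) a c * q_int (Suc (b + c))))"
    by (simp add: macmahon_Suc macmahon_commute[of a] ac_simps)
  also have "\<dots> = (macmahon b (Suc a) c * macmahon_step b (Suc a) c) *
      (macmahon a (Suc b) c * macmahon_step a (Suc b) c) * (q_int (Suc a) * q_int (Suc b))"
    unfolding macmahon_step_shift macmahon_commute[of "Suc _"] by (simp only: ac_simps)
  also have "\<dots> = macmahon (Suc b) (Suc a) c * macmahon (Suc a) (Suc b) c *
      (q_int (Suc a) * q_int (Suc b))"
    by (simp only: macmahon_Suc)
  also have "macmahon (Suc b) (Suc a) c = macmahon (Suc a) (Suc b) c"
    by (rule macmahon_commute)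
  finally show ?thesis by (simp only: power2_eq_square)
qed

lemma macmahon_height_ratio:
  "macmahon a b c * macmahon a b (Suc (Suc c)) *
     (q_int (Suc (a + c)) * q_int (Suc (b + c))) =
   (macmahon a b (Suc c))\<^sup>2 * (q_int (Suc c) * q_int (Suc (a + b + c)))"
proof -
  have "macmahon c a b * macmahon (Suc (Suc c)) a b *
      (q_int (Suc (c + a)) * q_int (Suc (c + b))) =
      macmahon c a b * macmahon (Suc c) a b *
      (macmahon_step (Suc c) a b * (q_int (Suc (c + a)) * q_int (Suc (c + b))))"
    by (simp only: macmahon_Suc[of "Suc c"] ac_simps)
  also have "\<dots> = (macmahon (Suc c) a b)\<^sup>2 * (q_int (Suc c) * q_int (Suc (c + a + b)))"
    unfolding macmahon_step_Suc by (simp only: macmahon_Suc[of c] power2_eq_square ac_simps)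
  finally show ?thesis by (simp add: macmahon_rotate[of a b] ac_simps)
qed

text \<open>
  The quotient of \<open>q\<close>-binomials contributed by the index \<open>j\<close> is the \<open>macmahon_step\<close> by which the
  box number grows when the side \<open>j\<close> is lengthened to \<open>j + 1\<close>.
\<close>

lemma q_hoggatt_fract_macmahon:
  "q_hoggatt_fract d (k + c) k = qvar ^ (d * k * (k - 1) div 2) * macmahon k d c"
proof -
  have "(\<Prod>j<d. q_binomial (k + c + j) k / q_binomial (k + j) k) = macmahon d k c"
  proof (induction d)
    case (Suc d)
    have "q_binomial (k + c + d) k / q_binomial (k + d) k =
        q_fact d * q_fact (d + k + c) / (q_fact (d + k) * q_fact (d + c))"
      using q_fact_nz by (simp add: q_binomial_def ac_simps)
    with Suc show ?case by (simp add: macmahon_Suc macmahon_step_def)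
  qed (simp add: macmahon_0)
  then show ?thesis by (simp add: q_hoggatt_fract_def macmahon_commute)
qed

text \<open>
  The analogue of Dodgson condensation for boxes. Multiplied by \<open>D\<close>, all three products become
  multiples of the same square, and the claim turns into the identity \<open>numbers\<close> for \<open>q\<close>-numbers.
\<close>

lemma macmahon_dodgson:
  "(macmahon (Suc a) (Suc b) (Suc c))\<^sup>2
     - macmahon (Suc a) (Suc b) c * macmahon (Suc a) (Suc b) (Suc (Suc c)) =
   qvar ^ Suc c * (macmahon (Suc (Suc a)) b (Suc c) * macmahon a (Suc (Suc b)) (Suc c))"
proof -
  define D where "D = q_int (Suc (Suc (a + c))) * q_int (Suc (Suc (b + c)))"
  have "D \<noteq> 0" by (simp add: D_def q_int_nz)
  have square: "macmahon (Suc a) (Suc b) c * macmahon (Suc a) (Suc b) (Suc (Suc c)) * D =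
      (macmahon (Suc a) (Suc b) (Suc c))\<^sup>2 *
        (q_int (Suc c) * q_int (Suc (Suc (Suc (a + b + c)))))"
    using macmahon_height_ratio[of "Suc a" "Suc b" c] by (simp add: D_def)
  have neighbours: "macmahon (Suc (Suc a)) b (Suc c) * macmahon a (Suc (Suc b)) (Suc c) * D =
      (macmahon (Suc a) (Suc b) (Suc c))\<^sup>2 * (q_int (Suc a) * q_int (Suc b))"
    using macmahon_exchange[of a b "Suc c"] by (simp add: D_def)
  have numbers: "D - q_int (Suc c) * q_int (Suc (Suc (Suc (a + b + c)))) =
      qvar ^ Suc c * (q_int (Suc a) * q_int (Suc b))"
  proof -
    define x y z u where "x = qvar ^ Suc a" and "y = qvar ^ Suc b" and "z = qvar ^ Suc c"
      and "u = inverse (1 - qvar)"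
    have powers: "qvar ^ Suc (Suc (a + c)) = x * z" "qvar ^ Suc (Suc (b + c)) = y * z"
      "qvar ^ Suc (Suc (Suc (a + b + c))) = x * y * z"
      by (simp_all add: x_def y_def z_def power_add)
    show ?thesis
      unfolding D_def q_int_def powers x_def[symmetric] y_def[symmetric] z_def[symmetric]
        divide_inverse u_def[symmetric]
      by (simp add: algebra_simps)
  qed
  have "((macmahon (Suc a) (Suc b) (Suc c))\<^sup>2
        - macmahon (Suc a) (Suc b) c * macmahon (Suc a) (Suc b) (Suc (Suc c))) * D =
      (macmahon (Suc a) (Suc b) (Suc c))\<^sup>2 *
        (D - q_int (Suc c) * q_int (Suc (Suc (Suc (a + b + c)))))"
    by (simp add: left_diff_distrib right_diff_distrib square)
  also have "\<dots> = qvar ^ Suc c *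
      (macmahon (Suc (Suc a)) b (Suc c) * macmahon a (Suc (Suc b)) (Suc c)) * D"
    unfolding numbers mult.assoc[of "qvar ^ Suc c"] neighbours by (simp only: ac_simps)
  finally show ?thesis using \<open>D \<noteq> 0\<close> by simp
qed

section \<open>Positivity of the box numbers and log-concavity\<close>

lemma prod_qvar_power_diff:
  "(\<Prod>i<d. qvar ^ (d + r) - qvar ^ i) =
   (\<Prod>i<d. qvar ^ i * (qvar - 1)) * (q_fact (d + r) / q_fact r)"
proof -
  have "(\<Prod>i<d. q_int (d + r - i)) = q_fact (d + r) / q_fact r"
    using q_fact_falling[of d "d + r"] q_fact_nz[of r] by simp
  then show ?thesis
    by (simp add: qvar_power_diff prod.distrib[symmetric] flip: \<open>_ = q_fact (d + r) / _\<close>)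
qed

text \<open>
  In \<open>d + k\<close> variables the rectangle with \<open>k\<close> rows of length \<open>c\<close> has \<open>d\<close> parts \<open>0\<close> and \<open>k\<close> parts
  \<open>c\<close>. Adding one more part multiplies both Vandermonde products by one row of factors: pairing the
  new part with the zero parts gives \<open>q\<close>-factorials, and pairing it with the other parts \<open>c\<close> gives
  \<open>q ^ c\<close> for each of them.
\<close>

lemma principal_schur_rectangle:
  "principal_schur (d + k) (\<lambda>i. if i < d then i else i + c) =
   qvar ^ (c * (\<Sum>j<k. j)) * macmahon k d c"
proof (induction k)
  case 0
  have "vandermonde d (\<lambda>i. qvar ^ (if i < d then i else i + c)) = vandermonde d (\<lambda>i. qvar ^ i)"
    by (rule vandermonde_cong) simp
  then show ?case by (simp add: principal_schur_def macmahon_0 vandermonde_qvar_nz)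
next
  case (Suc k)
  define l where "l = (\<lambda>i. if i < d then i else i + c)"
  have split: "(\<Prod>i<d + k. g i) = (\<Prod>i<d. g i) * (\<Prod>i<k. g (d + i))"
    for g :: "nat \<Rightarrow> real poly fract"
    by (induction k) (simp_all add: mult.assoc)
  define A where "A = (\<Prod>i<d. qvar ^ i * (qvar - 1))"
  define B where "B = (\<Prod>i<k. qvar ^ (d + k) - qvar ^ (d + i))"
  have nz: "A \<noteq> 0" "B \<noteq> 0"
    using qvar_nz qvar_power_neq_1[of 1] by (auto simp: A_def B_def qvar_power_diff q_int_nz)
  have "(\<Prod>i<d + k. qvar ^ l (d + k) - qvar ^ l i) =
      (\<Prod>i<d. qvar ^ (d + (k + c)) - qvar ^ i) *
      (\<Prod>i<k. qvar ^ c * (qvar ^ (d + k) - qvar ^ (d + i)))"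
    unfolding split by (simp add: l_def power_add algebra_simps)
  also have "\<dots> = A * (q_fact (d + (k + c)) / q_fact (k + c)) * (qvar ^ (c * k) * B)"
    unfolding prod_qvar_power_diff by (simp add: A_def B_def prod.distrib power_mult)
  finally have top: "(\<Prod>i<d + k. qvar ^ l (d + k) - qvar ^ l i) = \<dots>" .
  have bottom: "(\<Prod>i<d + k. qvar ^ (d + k) - qvar ^ i) = A * (q_fact (d + k) / q_fact k) * B"
    unfolding split prod_qvar_power_diff by (simp add: A_def B_def)
  have last: "(\<Prod>i<d + k. qvar ^ l (d + k) - qvar ^ l i) /
        (\<Prod>i<d + k. qvar ^ (d + k) - qvar ^ i) = qvar ^ (c * k) * macmahon_step k d c"
    unfolding top bottom macmahon_step_def using nz q_fact_nz by (simp add: ac_simps)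
  have "principal_schur (d + Suc k) l = principal_schur (d + k) l *
      ((\<Prod>i<d + k. qvar ^ l (d + k) - qvar ^ l i) / (\<Prod>i<d + k. qvar ^ (d + k) - qvar ^ i))"
    by (simp add: principal_schur_def vandermonde_def)
  then show ?case
    using Suc.IH unfolding l_def[symmetric] last
    by (simp add: macmahon_Suc power_add ring_distribs ac_simps)
qed

lemma macmahon_nonneg: "\<exists>e. qvar ^ e * macmahon k d c \<in> nonneg_fract"
  using principal_schur_nonneg[of "d + k" "\<lambda>i. if i < d then i else i + c"]
  by (intro exI[of _ "c * (\<Sum>j<k. j)"]) (simp add: principal_schur_rectangle)

theorem theorem6p7:
  fixes d k :: nat
  assumes "d \<ge> 1"
  shows "q_log_concave_from k (\<lambda>n. q_hoggatt d n k)"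
  unfolding q_log_concave_from_def
proof (intro allI impI)
  fix n i assume "n \<ge> k + 1"
  then obtain c where n: "n = k + Suc c"
    by (metis add.assoc le_iff_add add.commute plus_1_eq_Suc add_Suc_right)
  \<comment> \<open>The prefactor of \<open>H(n, k)\<close> is the same for all \<open>n\<close>, so it comes out of the difference.\<close>
  define e where "e = d * k * (k - 1) div 2"
  define P where "P = (q_hoggatt d n k)\<^sup>2 - q_hoggatt d (n - 1) k * q_hoggatt d (n + 1) k"
  have hoggatt: "to_fract (q_hoggatt d (k + m) k) = qvar ^ e * macmahon k d m" for m
    by (simp add: to_fract_q_hoggatt q_hoggatt_fract_macmahon e_def)
  have P: "to_fract P = qvar ^ (e + e) *
      ((macmahon k d (Suc c))\<^sup>2 - macmahon k d c * macmahon k d (Suc (Suc c)))"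
    using hoggatt[of c] hoggatt[of "Suc c"] hoggatt[of "Suc (Suc c)"]
    by (simp add: P_def n power2_eq_square power_add algebra_simps)
  show "0 \<le> coeff ((q_hoggatt d n k)\<^sup>2 - q_hoggatt d (n - 1) k * q_hoggatt d (n + 1) k) i"
  proof (cases k)
    case 0
    \<comment> \<open>There is no smaller box to pass to here; all terms of the sequence are equal.\<close>
    then have "to_fract P = 0" using P by (simp add: macmahon_0)
    then have "P = 0" by (simp only: to_fract_eq_0_iff)
    then show ?thesis unfolding P_def by simp
  next
    case (Suc a)
    obtain b where b: "d = Suc b" using assms by (cases d) auto
    obtain f g where nonneg: "qvar ^ f * macmahon (Suc k) b (Suc c) \<in> nonneg_fract"
      "qvar ^ g * macmahon a (Suc d) (Suc c) \<in> nonneg_fract"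
      using macmahon_nonneg by metis
    have "qvar ^ (f + g) * to_fract P = qvar ^ (e + e) * (qvar ^ Suc c *
        ((qvar ^ f * macmahon (Suc k) b (Suc c)) * (qvar ^ g * macmahon a (Suc d) (Suc c))))"
      unfolding P Suc b macmahon_dodgson by (simp only: power_add ac_simps)
    also have "\<dots> \<in> nonneg_fract"
      by (intro nonneg_fract_mult nonneg_fract_qvar_power nonneg)
    finally show ?thesis unfolding P_def by (rule nonneg_fract_qvar_cancel)
  qed
qed

end
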